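(* Let $n \ge 2$ and $t\ge 2$ be fixed integers and let $\mathcal{A} \subseteq \mathbb{F}_{q^n}$. Consider the system of $\binom{t}{2}$ norm equations $$N(X_i + X_j) = \lambda_{ij}\quad (1\le i<j\le t), \qquad X_i \in \mathcal{A},\ i = 1,\ldots,t.$$ Suppose that $|\mathcal{A}| \gg q^{(n+t)/2}$. Then the system is solvable for at least $(1-o(1)) q^{\binom{t}{2}}$ choices of $(\lambda_{ij})_{1\le i<j\le t}$ with $\lambda_{ij} \in \mathbb{F}_q$.
   Context: $q$ is a power of an odd prime, viewed as an asymptotic parameter: $q\to\infty$, the set $\mathcal{A}$ may depend on $q$, and $o(1)$ denotes a quantity tending to $0$ as $q\to\infty$. $X \ll Y$ (equivalently $Y \gg X$) means $X = o(Y)$. $\mathbb{F}_{q^n}$ is the extension of degree $n$ of the finite field $\mathbb{F}_q$. $N = N_{\mathbb{F}_{q^n}/\mathbb{F}_q}$ is the norm map, $N(X) = \prod_{i=0}^{n-1} X^{q^i} = X^{(q^n-1)/(q-1)}$, extended by $N(0)=0$. *)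

theory Defs
  imports "HOL-Algebra.Algebra" "HOL-Library.Landau_Symbols"
begin

text \<open>
  The norm of the extension \<open>F\<^sub>q\<^sup>n / F\<^sub>q\<close>, i.e. the product of all conjugates
  \<open>x^(q^i)\<close>, \<open>0 \<le> i < n\<close>.  The values lie in the carrier of the big field \<open>K\<close> (inside its
  subfield of order \<open>q\<close>), and the norm of zero is zero as soon as \<open>n > 0\<close>.
\<close>

definition field_norm :: "('a, 'b) ring_scheme \<Rightarrow> nat \<Rightarrow> nat \<Rightarrow> 'a \<Rightarrow> 'a" where
  "field_norm K q n x = finprod K (\<lambda>i. x [^]\<^bsub>K\<^esub> (q ^ i)) {..<n}"

definition index_pairs :: "nat \<Rightarrow> (nat \<times> nat) set" where
  "index_pairs t = {(i, j). 1 \<le> i \<and> i < j \<and> j \<le> t}"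

definition norm_system_solvable ::
  "('a, 'b) ring_scheme \<Rightarrow> nat \<Rightarrow> nat \<Rightarrow> nat \<Rightarrow> 'a set \<Rightarrow> (nat \<times> nat \<Rightarrow> 'a) \<Rightarrow> bool" where
  "norm_system_solvable K q n t A l \<longleftrightarrow>
     (\<exists>x :: nat \<Rightarrow> 'a. (\<forall>i\<in>{1..t}. x i \<in> A) \<and>
        (\<forall>(i, j)\<in>index_pairs t. field_norm K q n (x i \<oplus>\<^bsub>K\<^esub> x j) = l (i, j)))"

text \<open>
  The choices of \<open>(\<lambda>\<^sub>i\<^sub>j)\<close> with entries in the subfield \<open>F\<close> are the extensional functions on
  the index pairs, so that there are exactly \<open>card F ^ (t choose 2)\<close> of them.
\<close>

definition solvable_choices ::
  "('a, 'b) ring_scheme \<Rightarrow> 'a set \<Rightarrow> nat \<Rightarrow> nat \<Rightarrow> 'a set \<Rightarrow> (nat \<times> nat \<Rightarrow> 'a) set" where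
  "solvable_choices K F n t A =
     {l \<in> index_pairs t \<rightarrow>\<^sub>E F. norm_system_solvable K (card F) n t A l}"

end

theory Submission
  imports Defs "HOL-Analysis.Convex"
begin

text \<open>
  Colour a pair \<open>(x, z)\<close> of elements of the big field by the norm \<open>N (x + z)\<close>.  A tuple
  \<open>(x\<^sub>1, \<dots>, x\<^sub>t)\<close> of elements of \<open>A\<close> then has a colour pattern, one colour for each pair
  \<open>i < j\<close>, and the solvable right-hand sides are exactly the patterns that occur.  The proof shows
  more than solvability: the pattern of a uniformly random tuple is close in total variation to
  the uniform distribution on patterns of nonzero colours.  Patterns that do not occur make up
  at most the total variation error.  The patterns with some zero entry are a proportion
  \<open>O(1/q)\<close> of all patterns and are simply given up.

  Everything rests on one property of a single edge.  For a set \<open>B\<close> in the big field, the number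
  of \<open>z \<in> B\<close> with \<open>N (x + z) = c\<close> deviates from \<open>|B| / (q - 1)\<close> in such a way that the squared
  deviations, summed over all \<open>x\<close> and all \<open>c \<noteq> 0\<close>, are at most \<open>q\<^sup>n |B|\<close>
  (\<open>sum_deviation_sq_le\<close>, \<open>norm_colouring_mixing\<close>).  The reason is that expanding
  the square leads to the number of \<open>x\<close> with \<open>N (x + z) = N (x + w) \<noteq> 0\<close>, and for \<open>z \<noteq> w\<close> such an
  \<open>x\<close> is determined by \<open>u = (x + z) / (x + w)\<close>, which is an element of norm one other than \<open>1\<close>
  (\<open>card_equal_norm_shifts_le\<close>).

  The pattern is revealed edge by edge (\<open>new_edge_discrepancy\<close>, \<open>colouring_discrepancy\<close>).  When
  the edge \<open>ij\<close> is added, fix all entries of the tuple except \<open>x\<^sub>j\<close> and fix the colours of the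
  earlier edges at \<open>j\<close>.  Then \<open>x\<^sub>j\<close> runs through a subset \<open>B\<close> of \<open>A\<close> which does not depend on
  \<open>x\<^sub>i\<close>, as the edge \<open>ij\<close> was not present before.  Hence the variance bound applies to \<open>x\<^sub>i\<close> and
  \<open>B\<close>.  Summing over all choices with the Cauchy-Schwarz inequality costs a factor \<open>q\<close> under the
  root for every edge at \<open>j\<close>, the new one included.  These are at most \<open>t - 1\<close>, so one edge
  changes the total variation distance by at most \<open>q\<close> to the power \<open>(n + t - 1) / 2\<close>, divided by
  \<open>|A|\<close>.  This tends to zero under the assumption on \<open>|A|\<close>, and the number of edges is fixed.

  The point of working with averages over all patterns is that the sets \<open>B\<close> for the
  different colours at \<open>j\<close> are disjoint.  Their sizes sum to at most \<open>|A|\<close>, whereas embedding a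
  prescribed pattern would require control of each of these small sets separately.
\<close>

section \<open>Norms in a finite extension\<close>

lemma geometric_sum_nat: "((q::nat) - 1) * (\<Sum>i<n. q ^ i) = q ^ n - 1"
proof (cases q)
  case 0
  then show ?thesis by (cases n) auto
next
  case (Suc k)
  have "k * (\<Sum>i<n. Suc k ^ i) + 1 = Suc k ^ n"
    by (induction n) (auto simp: algebra_simps)
  then show ?thesis using Suc by simp
qed

lemma (in field) field_norm_eq_pow:
  assumes "x \<in> carrier R"
  shows "field_norm R q n x = x [^] (\<Sum>i<n. q ^ i)"
proof (induction n)
  case 0
  show ?case by (simp add: field_norm_def)
next
  case (Suc n)
  have "field_norm R q (Suc n) x = x [^] (q ^ n) \<otimes> field_norm R q n x"
    using assms by (simp add: field_norm_def lessThan_Suc Pi_def)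
  then show ?case
    using Suc assms by (simp add: nat_pow_mult add.commute)
qed

lemma (in field) card_eq_card_subfield_power:
  assumes F: "subfield F R" and dim: "dimension n F (carrier R)" and fin: "finite F"
  shows "finite (carrier R)" and "card (carrier R) = card F ^ n"
proof -
  obtain Vs where Vs: "set Vs \<subseteq> carrier R" "independent F Vs" "length Vs = n"
      "Span F Vs = carrier R"
    using exists_base[OF F dim] by blast
  let ?L = "{Ks. set Ks \<subseteq> F \<and> length Ks = n}"
  have onto: "(\<lambda>Ks. combine Ks Vs) ` ?L = carrier R"
    unfolding Vs(4)[symmetric] Span_eq_combine_set_length_version[OF F Vs(1)] Vs(3)
    by blast
  have "inj_on (\<lambda>Ks. combine Ks Vs) ?L"
  proof (rule inj_onI)
    fix Ks Ls assume KL: "Ks \<in> ?L" "Ls \<in> ?L" "combine Ks Vs = combine Ls Vs"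
    have "combine Ks Vs \<in> Span F Vs"
      using onto KL(1) Vs(4) by blast
    from unique_decomposition[OF F Vs(2) this]
    obtain Ms where "\<And>Ls. set Ls \<subseteq> F \<and> length Ls = length Vs \<and> combine Ks Vs = combine Ls Vs \<Longrightarrow> Ls = Ms"
      by (elim ex1E) iprover
    from this[of Ks] this[of Ls] show "Ks = Ls"
      using KL Vs(3) by simp
  qed
  then have bij: "bij_betw (\<lambda>Ks. combine Ks Vs) ?L (carrier R)"
    using onto by (simp add: bij_betw_def)
  show "finite (carrier R)"
    using bij_betw_finite[OF bij] finite_lists_length_eq[OF fin] by simp
  show "card (carrier R) = card F ^ n"
    using bij_betw_same_card[OF bij] card_lists_length_eq[OF fin] by simp
qed

lemma (in field) pow_card_minus_one:
  assumes "finite (carrier R)" "x \<in> carrier R" "x \<noteq> \<zero>"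
  shows "x [^] (card (carrier R) - 1) = \<one>"
  using group.pow_order_eq_1[OF field_mult_group, of x] assms order_mult_of[OF assms(1)]
  by (simp add: Multiplicative_Group.nat_pow_mult_of order_def)

text \<open>
  The nonzero elements of the subfield are roots of unity of order dividing \<open>card F - 1\<close>, and there
  are already as many of them as the polynomial \<open>X\<close> to the power \<open>card F - 1\<close> minus \<open>1\<close> can have
  roots.  This criterion is what shows below that norms lie in the subfield.
\<close>

lemma (in field) subfield_nonzero_eq_roots_of_unity:
  assumes F: "subfield F R" and fin: "finite (carrier R)"
  shows "F - {\<zero>} = {x \<in> carrier R. x [^] (card F - 1) = \<one>}"
proof (rule card_subset_eq)
  have sub: "F \<subseteq> carrier R" and zero: "\<zero> \<in> F" and one: "\<one> \<in> F"
    using subfieldE(3)[OF F] subringE[OF subfieldE(1)[OF F]] by auto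
  have finF: "finite F" using finite_subset[OF sub fin] .
  have gt: "card F > 1"
    using card_mono[OF finF, of "{\<zero>, \<one>}"] zero one by simp
  interpret S: field "R\<lparr>carrier := F\<rparr>"
    using subfield_iff(2)[OF F] .
  show "finite {x \<in> carrier R. x [^] (card F - 1) = \<one>}" using fin by simp
  show *: "F - {\<zero>} \<subseteq> {x \<in> carrier R. x [^] (card F - 1) = \<one>}"
    using S.pow_card_minus_one finF sub by (auto simp flip: nat_pow_consistent)
  show "card (F - {\<zero>}) = card {x \<in> carrier R. x [^] (card F - 1) = \<one>}"
  proof (rule antisym)
    show "card (F - {\<zero>}) \<le> card {x \<in> carrier R. x [^] (card F - 1) = \<one>}"
      using card_mono[OF _ *] fin by simp
    have "card {x \<in> carrier R. x [^] (card F - 1) = \<one>} \<le> card F - 1"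
      using num_roots_le_deg[OF fin] gt by simp
    then show "card {x \<in> carrier R. x [^] (card F - 1) = \<one>} \<le> card (F - {\<zero>})"
      using zero finF by simp
  qed
qed

lemma (in field) field_norm_nonzero_iff:
  assumes F: "subfield F R" and dim: "dimension n F (carrier R)" and fin: "finite F"
    and n: "n > 0" and x: "x \<in> carrier R"
  shows "field_norm R (card F) n x \<in> F - {\<zero>} \<longleftrightarrow> x \<noteq> \<zero>"
proof -
  note K = card_eq_card_subfield_power[OF F dim fin]
  have gp: "(card F - 1) * (\<Sum>i<n. card F ^ i) = card F ^ n - 1"
    by (rule geometric_sum_nat)
  have pos: "(\<Sum>i<n. card F ^ i) > 0"
    using n by (intro sum_pos2[of _ 0]) auto
  show ?thesis
  proof
    assume "x \<noteq> \<zero>"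
    then have "(x [^] (\<Sum>i<n. card F ^ i)) [^] (card F - 1) = \<one>"
      using pow_card_minus_one[OF K(1) x] gp x K(2)
      by (simp add: nat_pow_pow mult.commute)
    then show "field_norm R (card F) n x \<in> F - {\<zero>}"
      using subfield_nonzero_eq_roots_of_unity[OF F K(1)] x
      by (simp add: field_norm_eq_pow)
  next
    assume "field_norm R (card F) n x \<in> F - {\<zero>}"
    moreover have "field_norm R (card F) n \<zero> = \<zero>"
      using nat_pow_zero[OF less_imp_neq[OF pos, symmetric]] by (simp only: field_norm_eq_pow zero_closed)
    ultimately show "x \<noteq> \<zero>" by auto
  qed
qed

text \<open>
  The quotient \<open>u = (x + z) / (x + w)\<close> has norm one, and \<open>u \<noteq> 1\<close> since \<open>z \<noteq> w\<close>.  It determines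
  \<open>x\<close>, because \<open>x + z = u (x + w)\<close> is a linear equation for \<open>x\<close> with leading coefficient
  \<open>1 - u \<noteq> 0\<close>.  The elements of norm one are the roots of a polynomial whose degree is the sum
  on the right-hand side.
\<close>

lemma (in field) card_equal_norm_shifts_le:
  assumes F: "subfield F R" and dim: "dimension n F (carrier R)" and fin: "finite F"
    and n: "n > 0" and z: "z \<in> carrier R" and w: "w \<in> carrier R" and "z \<noteq> w"
  defines "N \<equiv> field_norm R (card F) n"
  shows "card {x \<in> carrier R. N (x \<oplus> z) \<in> F - {\<zero>} \<and> N (x \<oplus> z) = N (x \<oplus> w)}
         \<le> (\<Sum>i<n. card F ^ i) - 1"
proof -
  let ?M = "\<Sum>i<n. card F ^ i"
  let ?X = "{x \<in> carrier R. N (x \<oplus> z) \<in> F - {\<zero>} \<and> N (x \<oplus> z) = N (x \<oplus> w)}"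
  let ?U = "{u \<in> carrier R. u [^] ?M = \<one>}"
  let ?f = "\<lambda>x. (x \<oplus> z) \<otimes> inv (x \<oplus> w)"
  note K = card_eq_card_subfield_power[OF F dim fin]
  have pos: "?M > 0"
    using n by (intro sum_pos2[of _ 0]) auto
  have nz: "x \<oplus> z \<noteq> \<zero>" "x \<oplus> w \<noteq> \<zero>" "x \<in> carrier R" if "x \<in> ?X" for x
    using that field_norm_nonzero_iff[OF F dim fin n, of "x \<oplus> z"]
      field_norm_nonzero_iff[OF F dim fin n, of "x \<oplus> w"] z w by (auto simp: N_def)
  have inv: "inv (x \<oplus> w) \<in> carrier R" "inv (x \<oplus> w) \<otimes> (x \<oplus> w) = \<one>" if "x \<in> ?X" for x
    using nz[OF that] w by (auto simp: field_Units)
  have clear: "?f x \<otimes> (x \<oplus> w) = x \<oplus> z" if "x \<in> ?X" for x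
    using inv[OF that] nz[OF that] z w by (simp add: m_assoc)
  have ne1: "?f x \<noteq> \<one>" if "x \<in> ?X" for x
  proof
    assume "?f x = \<one>"
    then have "x \<oplus> w = x \<oplus> z" using clear[OF that] nz[OF that] w by simp
    then show False using nz[OF that] z w \<open>z \<noteq> w\<close> by simp
  qed
  have image: "?f ` ?X \<subseteq> ?U - {\<one>}"
  proof (rule image_subsetI)
    fix x assume X: "x \<in> ?X"
    then have x: "x \<in> carrier R" and eq: "N (x \<oplus> z) = N (x \<oplus> w)" by auto
    note i = inv[OF X]
    have pw: "(x \<oplus> z) [^] ?M = (x \<oplus> w) [^] ?M"
      using eq x z w by (simp add: N_def field_norm_eq_pow)
    have "?f x [^] ?M = (x \<oplus> w) [^] ?M \<otimes> inv (x \<oplus> w) [^] ?M"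
      using i(1) x z w pw by (simp add: nat_pow_distrib)
    also have "\<dots> = (inv (x \<oplus> w) \<otimes> (x \<oplus> w)) [^] ?M"
      using i(1) x w by (simp add: nat_pow_distrib m_comm)
    also have "\<dots> = \<one>" using i(2) by simp
    finally have "?f x [^] ?M = \<one>" .
    moreover have "?f x \<in> carrier R" using i(1) x z by simp
    ultimately show "?f x \<in> ?U - {\<one>}" using ne1[OF X] by blast
  qed
  have "inj_on ?f ?X"
  proof (rule inj_onI)
    fix x y assume X: "x \<in> ?X" and Y: "y \<in> ?X" and eq: "?f x = ?f y"
    define u where "u = ?f x"
    have c: "x \<in> carrier R" "y \<in> carrier R" "u \<in> carrier R"
      using nz[OF X] nz[OF Y] inv[OF X] z by (auto simp: u_def)
    have e1: "u \<otimes> (x \<oplus> w) = x \<oplus> z" and e2: "u \<otimes> (y \<oplus> w) = y \<oplus> z"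
      using clear[OF X] clear[OF Y] eq by (auto simp: u_def)
    \<comment> \<open>Subtract the linear equations satisfied by \<open>x\<close> and \<open>y\<close>.\<close>
    have "(u \<ominus> \<one>) \<otimes> (x \<ominus> y) = (u \<otimes> (x \<oplus> w) \<ominus> (x \<oplus> z)) \<ominus> (u \<otimes> (y \<oplus> w) \<ominus> (y \<oplus> z))"
      using c z w by algebra
    also have "\<dots> = \<zero>" unfolding e1 e2 using c z w by algebra
    finally have "u \<ominus> \<one> = \<zero> \<or> x \<ominus> y = \<zero>" using integral c by blast
    then show "x = y"
      using ne1[OF X] c by (auto simp: r_right_minus_eq u_def)
  qed
  then have "card ?X \<le> card (?U - {\<one>})"
    by (rule card_inj_on_le[OF _ image]) (use K(1) in simp)
  also have "\<dots> = card ?U - 1" by simp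
  also have "\<dots> \<le> ?M - 1" using num_roots_le_deg[OF K(1) less_imp_neq[OF pos, symmetric]] by (rule diff_le_mono)
  finally show ?thesis .
qed

section \<open>Mixing from codegrees\<close>

text \<open>
  A second moment computation.  Expanding the square gives the codegrees of the pairs in \<open>B\<close>; the
  pairs \<open>z = w\<close> contribute the main part of the bound, while the pairs \<open>z \<noteq> w\<close> cancel against the
  square of the mean.  The cancellation has to be exact, because \<open>B\<close> may be of any size: a
  codegree exceeding \<open>L - 1\<close> by a constant factor would leave a term of order \<open>(card B)\<^sup>2 * L\<close>.
  For the same reason the mean is taken over the colours in \<open>C\<close> alone.  In the application \<open>C\<close>
  consists of the nonzero colours, and the zero colour, which is much rarer, is left out.
\<close>

lemma sum_deviation_sq_le:
  fixes colour :: "'v \<Rightarrow> 'w \<Rightarrow> 'c" and r L :: nat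
  assumes fS: "finite S" and fB: "finite B" and fC: "finite C" and r: "card C = r" "r > 0"
    and L: "L > 0" and card_S: "card S = r * L + 1"
    and deg: "\<And>z. z \<in> B \<Longrightarrow> card {x \<in> S. colour x z \<in> C} = r * L"
    and codeg: "\<And>z w. z \<in> B \<Longrightarrow> w \<in> B \<Longrightarrow> z \<noteq> w \<Longrightarrow>
      card {x \<in> S. colour x z \<in> C \<and> colour x z = colour x w} \<le> L - 1"
  shows "(\<Sum>x\<in>S. \<Sum>c\<in>C. (real (card {z \<in> B. colour x z = c}) - card B / r)\<^sup>2)
         \<le> real (card S) * card B"
proof -
  let ?d = "\<lambda>x c. real (card {z \<in> B. colour x z = c})"
  define b where "b = real (card B)"
  define \<rho> where "\<rho> = real r"
  define l where "l = real L"
  have rho: "\<rho> \<ge> 1" using r by (simp add: \<rho>_def)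
  have d: "?d x c = (\<Sum>z\<in>B. of_bool (colour x z = c))" for x c
    using fB by (simp add: sum.If_cases of_bool_def Int_def)
  have S1: "(\<Sum>x\<in>S. \<Sum>c\<in>C. ?d x c) = b * (\<rho> * l)"
  proof -
    have "(\<Sum>x\<in>S. \<Sum>c\<in>C. ?d x c) = (\<Sum>x\<in>S. \<Sum>z\<in>B. \<Sum>c\<in>C. of_bool (colour x z = c))"
      unfolding d by (subst sum.swap) simp
    also have "\<dots> = (\<Sum>x\<in>S. \<Sum>z\<in>B. of_bool (colour x z \<in> C))"
      using fC by (simp add: of_bool_def sum.delta')
    also have "\<dots> = (\<Sum>z\<in>B. real (card {x \<in> S. colour x z \<in> C}))"
      using fS by (subst sum.swap) (simp add: sum.If_cases of_bool_def Int_def)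
    also have "\<dots> = b * (\<rho> * l)"
      using deg by (simp add: b_def \<rho>_def l_def)
    finally show ?thesis .
  qed
  have S2: "(\<Sum>x\<in>S. \<Sum>c\<in>C. (?d x c)\<^sup>2) \<le> b * (\<rho> * l) + b * (b - 1) * (l - 1)"
  proof -
    have "(\<Sum>c\<in>C. (?d x c)\<^sup>2) =
        (\<Sum>z\<in>B. \<Sum>w\<in>B. of_bool (colour x z \<in> C \<and> colour x z = colour x w))" for x
    proof -
      have "(\<Sum>c\<in>C. (?d x c)\<^sup>2) =
          (\<Sum>c\<in>C. \<Sum>z\<in>B. \<Sum>w\<in>B. of_bool (colour x z = c) * of_bool (colour x w = c))"
        unfolding d power2_eq_square sum_product ..
      also have "\<dots> = (\<Sum>z\<in>B. \<Sum>w\<in>B. \<Sum>c\<in>C. of_bool (colour x z = c) * of_bool (colour x w = c))"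
        by (subst sum.swap, intro sum.cong refl, subst sum.swap) simp
      also have "\<dots> = (\<Sum>z\<in>B. \<Sum>w\<in>B. of_bool (colour x z \<in> C \<and> colour x z = colour x w))"
      proof (intro sum.cong refl)
        fix z w
        have "(\<Sum>c\<in>C. of_bool (colour x z = c) * of_bool (colour x w = c)) =
            (\<Sum>c\<in>C. if colour x z = c then of_bool (colour x z = colour x w) else (0::real))"
          by (intro sum.cong) auto
        then show "(\<Sum>c\<in>C. of_bool (colour x z = c) * of_bool (colour x w = c)) =
            (of_bool (colour x z \<in> C \<and> colour x z = colour x w) :: real)"
          using fC by (simp add: sum.delta')
      qed
      finally show ?thesis .
    qed
    then have "(\<Sum>x\<in>S. \<Sum>c\<in>C. (?d x c)\<^sup>2) =
        (\<Sum>x\<in>S. \<Sum>z\<in>B. \<Sum>w\<in>B. of_bool (colour x z \<in> C \<and> colour x z = colour x w))"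
      by simp
    also have "\<dots> = (\<Sum>z\<in>B. \<Sum>w\<in>B. \<Sum>x\<in>S. of_bool (colour x z \<in> C \<and> colour x z = colour x w))"
      by (subst sum.swap, intro sum.cong refl, subst sum.swap) simp
    also have "\<dots> = (\<Sum>z\<in>B. \<Sum>w\<in>B. real (card {x \<in> S. colour x z \<in> C \<and> colour x z = colour x w}))"
      using fS by (simp add: sum.If_cases of_bool_def Int_def)
    also have "\<dots> \<le> (\<Sum>z\<in>B. \<rho> * l + (b - 1) * (l - 1))"
    proof (rule sum_mono)
      fix z assume z: "z \<in> B"
      have "(\<Sum>w\<in>B. real (card {x \<in> S. colour x z \<in> C \<and> colour x z = colour x w})) =
          \<rho> * l + (\<Sum>w\<in>B - {z}. real (card {x \<in> S. colour x z \<in> C \<and> colour x z = colour x w}))"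
        using deg[OF z] by (subst sum.remove[OF fB z]) (simp add: \<rho>_def l_def)
      also have "\<dots> \<le> \<rho> * l + (\<Sum>w\<in>B - {z}. l - 1)"
      proof (intro add_left_mono sum_mono)
        fix w assume "w \<in> B - {z}"
        then have "real (card {x \<in> S. colour x z \<in> C \<and> colour x z = colour x w}) \<le> real (L - 1)"
          using codeg[OF z, of w] by (intro of_nat_mono) auto
        then show "real (card {x \<in> S. colour x z \<in> C \<and> colour x z = colour x w}) \<le> l - 1"
          using L by (simp add: l_def of_nat_diff)
      qed
      also have "(\<Sum>w\<in>B - {z}. l - 1) = (b - 1) * (l - 1)"
      proof -
        have "card B \<ge> 1" using z fB by (simp add: Suc_le_eq card_gt_0_iff) blast
        then show ?thesis using z fB by (simp add: b_def of_nat_diff)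
      qed
      finally show "(\<Sum>w\<in>B. real (card {x \<in> S. colour x z \<in> C \<and> colour x z = colour x w}))
          \<le> \<rho> * l + (b - 1) * (l - 1)" .
    qed
    also have "\<dots> = b * (\<rho> * l) + b * (b - 1) * (l - 1)"
      by (simp add: b_def algebra_simps)
    finally show ?thesis .
  qed
  have S0: "(\<Sum>x\<in>S. \<Sum>c\<in>C. (b / \<rho>)\<^sup>2) = (\<rho> * l + 1) * (\<rho> * (b / \<rho>)\<^sup>2)"
    using r card_S by (simp add: \<rho>_def l_def)
  have "(\<Sum>x\<in>S. \<Sum>c\<in>C. (?d x c - b / \<rho>)\<^sup>2) =
      (\<Sum>x\<in>S. \<Sum>c\<in>C. (?d x c)\<^sup>2 - 2 * (b / \<rho>) * ?d x c + (b / \<rho>)\<^sup>2)"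
    by (intro sum.cong refl) (simp add: power2_diff)
  also have "\<dots> =
      (\<Sum>x\<in>S. \<Sum>c\<in>C. (?d x c)\<^sup>2) - 2 * (b / \<rho>) * (\<Sum>x\<in>S. \<Sum>c\<in>C. ?d x c)
        + (\<Sum>x\<in>S. \<Sum>c\<in>C. (b / \<rho>)\<^sup>2)"
    by (simp only: sum.distrib sum_subtractf sum_distrib_left)
  also have "\<dots> \<le> b * (\<rho> * l) + b * (b - 1) * (l - 1) - 2 * (b / \<rho>) * (b * (\<rho> * l))
      + (\<rho> * l + 1) * (\<rho> * (b / \<rho>)\<^sup>2)"
    unfolding S1 S0 using S2 by linarith
  also have "\<dots> = (\<rho> * l + 1) * b - b * l - b\<^sup>2 * (1 - 1 / \<rho>)"
    using rho by (simp add: field_simps power2_eq_square)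
  also have "\<dots> \<le> (\<rho> * l + 1) * b"
  proof -
    have "b * l \<ge> 0" "b\<^sup>2 * (1 - 1 / \<rho>) \<ge> 0" using rho by (auto simp: b_def l_def)
    then show ?thesis by linarith
  qed
  finally show ?thesis
    using card_S by (simp add: b_def \<rho>_def l_def add.commute)
qed

section \<open>Colour patterns of tuples\<close>

definition realisations ::
  "'v set \<Rightarrow> 'a set \<Rightarrow> ('a \<Rightarrow> 'a \<Rightarrow> 'c) \<Rightarrow> ('v \<times> 'v) set \<Rightarrow> ('v \<times> 'v \<Rightarrow> 'c) \<Rightarrow> ('v \<Rightarrow> 'a) set"
  where "realisations V A colour E l =
    {x \<in> V \<rightarrow>\<^sub>E A. \<forall>e\<in>E. colour (x (fst e)) (x (snd e)) = l e}"

lemma sum_PiE_insert: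
  assumes "e \<notin> E"
  shows "(\<Sum>l\<in>insert e E \<rightarrow>\<^sub>E C. g l) = (\<Sum>l\<in>E \<rightarrow>\<^sub>E C. \<Sum>c\<in>C. g (l(e := c)))"
proof -
  have "(\<Sum>l\<in>insert e E \<rightarrow>\<^sub>E C. g l) = (\<Sum>(c, l)\<in>C \<times> (E \<rightarrow>\<^sub>E C). g (l(e := c)))"
    unfolding PiE_insert_eq
    by (subst sum.reindex[OF inj_combinator[OF assms]]) (simp add: case_prod_unfold)
  also have "\<dots> = (\<Sum>c\<in>C. \<Sum>l\<in>E \<rightarrow>\<^sub>E C. g (l(e := c)))"
    by (simp add: sum.cartesian_product)
  finally show ?thesis by (subst sum.swap)
qed

text \<open>
  Conditioned on its pattern on \<open>E\<close>, a random tuple has an almost uniform colour on a new edge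
  \<open>(i, j)\<close>, on average over the patterns.  Freeze the tuple \<open>y\<close> of all entries other than the one
  at \<open>j\<close>.  The entry at \<open>j\<close> then ranges over the set \<open>B y l\<close> of those \<open>z\<close> that give the edges at
  \<open>j\<close> their prescribed colours.  Since none of these edges contains \<open>i\<close>, the set does not change
  with \<open>y i\<close>, and the mixing hypothesis can be applied with \<open>x = y i\<close> and \<open>B = B y l\<close>.  It enters
  as an \<open>L\<^sup>2\<close> bound; the Cauchy-Schwarz inequality over all triples of \<open>y\<close>, a pattern on the edges
  at \<open>j\<close> and a new colour turns it into the \<open>L\<^sup>1\<close> bound that is asserted.
\<close>

lemma new_edge_discrepancy:
  fixes D :: real and r :: nat and colour :: "'a \<Rightarrow> 'a \<Rightarrow> 'c"
  assumes fA: "finite A" and fC: "finite C" and r: "card C = r" "r > 0"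
    and D: "D \<ge> 0"
    and mixing: "\<And>B. B \<subseteq> A \<Longrightarrow>
      (\<Sum>x\<in>A. \<Sum>c\<in>C. (real (card {z \<in> B. colour x z = c}) - card B / r)\<^sup>2) \<le> D * card B"
    and fV: "finite V" and E: "finite E" and ij: "i \<in> V" "j \<in> V" "i \<noteq> j"
    and new: "(i, j) \<notin> E" "(j, i) \<notin> E"
    and deg: "card {e \<in> E. fst e = j \<or> snd e = j} + 1 \<le> m"
  shows "(\<Sum>l\<in>E \<rightarrow>\<^sub>E C. \<Sum>c\<in>C.
           \<bar>real (card {x \<in> realisations V A colour E l. colour (x i) (x j) = c})
             - card (realisations V A colour E l) / r\<bar>)
         \<le> real (card A) ^ (card V - 1) * sqrt (D * real r ^ m)"
proof (cases "A = {}")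
  case True
  then have "realisations V A colour E l = {}" for l
    using ij by (auto simp: realisations_def PiE_def Pi_def)
  then show ?thesis using D by simp
next
  case False
  define Y where "Y = (V - {j} \<rightarrow>\<^sub>E A)"
  define Z where "Z = (V - {i, j} \<rightarrow>\<^sub>E A)"
  define Ej where "Ej = {e \<in> E. fst e = j \<or> snd e = j}"
  define ok where "ok l y \<longleftrightarrow> (\<forall>e\<in>E - Ej. colour (y (fst e)) (y (snd e)) = l e)"
    for l and y :: "_ \<Rightarrow> 'a"
  define B where "B y l = {z \<in> A. \<forall>e\<in>Ej. colour ((y(j := z)) (fst e)) ((y(j := z)) (snd e)) = l e}"
    for l and y :: "_ \<Rightarrow> 'a"
  define dev where "dev x S c = real (card {z \<in> S. colour x z = c}) - card S / r" for x c and S :: "'a set"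
  have fY: "finite Y" "finite Z" and fEj: "finite Ej" and fEC: "finite (E \<rightarrow>\<^sub>E C)" "finite (Ej \<rightarrow>\<^sub>E C)"
    and fB: "finite (B y l)" and BA: "B y l \<subseteq> A" for y l
    using fV fA E fC by (auto simp: Y_def Z_def Ej_def B_def intro!: finite_PiE)
  have EjE: "Ej \<subseteq> E" by (auto simp: Ej_def)
  have Vj: "V = insert j (V - {j})" and Vij: "V - {j} = insert i (V - {i, j})" using ij by auto
  have cardV: "card V \<ge> 2" using card_mono[OF fV, of "{i, j}"] ij by simp
  have cardY: "card Y = card A ^ (card V - 1)" and cardZ: "card Z = card A ^ (card V - 2)"
    using fV ij by (auto simp: Y_def Z_def card_PiE numeral_2_eq_2)
  \<comment> \<open>Decompose a tuple into its entry at \<open>j\<close> and the rest.  The edges away from \<open>j\<close> constrain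
    only the rest.\<close>
  have split: "card {x \<in> realisations V A colour E l. P (x i) (x j)} =
      (\<Sum>y | y \<in> Y \<and> ok l y. card {z \<in> B y l. P (y i) z})" for l P
  proof -
    have "{x \<in> realisations V A colour E l. P (x i) (x j)} =
        (\<lambda>(y, z). y(j := z)) ` (SIGMA y:{y. y \<in> Y \<and> ok l y}. {z \<in> B y l. P (y i) z})"
      (is "?L = ?f ` ?S")
    proof -
      have mem: "y(j := z) \<in> ?L \<longleftrightarrow> ok l y \<and> z \<in> B y l \<and> P (y i) z" if "y \<in> Y" "z \<in> A" for y z
      proof -
        have "y(j := z) \<in> V \<rightarrow>\<^sub>E A"
          using that unfolding Y_def by (subst Vj) (rule PiE_fun_upd, auto)
        moreover have "(\<forall>e\<in>E. colour ((y(j := z)) (fst e)) ((y(j := z)) (snd e)) = l e) \<longleftrightarrow>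
            ok l y \<and> (\<forall>e\<in>Ej. colour ((y(j := z)) (fst e)) ((y(j := z)) (snd e)) = l e)"
          by (auto simp: ok_def Ej_def)
        ultimately show ?thesis
          using that ij by (auto simp: realisations_def B_def)
      qed
      have onto: "\<exists>y\<in>Y. \<exists>z\<in>A. x = y(j := z)" if "x \<in> V \<rightarrow>\<^sub>E A" for x
        using that PiE_insert_eq[of j "V - {j}" "\<lambda>_. A"] Vj by (auto simp: Y_def)
      show ?thesis
      proof (intro antisym subsetI)
        fix x assume x: "x \<in> ?L"
        then obtain y z where yz: "y \<in> Y" "z \<in> A" "x = y(j := z)"
          using onto[of x] unfolding realisations_def by blast
        then have "(y, z) \<in> ?S" using mem[of y z] x by blast
        then show "x \<in> ?f ` ?S" using yz(3) by (intro image_eqI[of _ _ "(y, z)"]) simp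
      next
        fix x assume "x \<in> ?f ` ?S"
        then obtain y z where yz: "y \<in> Y" "ok l y" "z \<in> B y l" "P (y i) z" "x = y(j := z)"
          by auto
        then show "x \<in> ?L" using mem[of y z] BA by blast
      qed
    qed
    moreover have "inj_on (\<lambda>(y, z). y(j := z)) (Y \<times> A)"
      using inj_combinator[of j "V - {j}" "\<lambda>_. A"] by (fastforce simp: inj_on_def Y_def)
    then have "inj_on (\<lambda>(y, z). y(j := z)) (SIGMA y:{y. y \<in> Y \<and> ok l y}. {z \<in> B y l. P (y i) z})"
      by (rule inj_on_subset) (use BA in auto)
    ultimately have "card {x \<in> realisations V A colour E l. P (x i) (x j)} =
        card (SIGMA y:{y. y \<in> Y \<and> ok l y}. {z \<in> B y l. P (y i) z})"
      by (simp add: card_image)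
    also have "\<dots> = (\<Sum>y | y \<in> Y \<and> ok l y. card {z \<in> B y l. P (y i) z})"
      using fY fB by (subst card_SigmaI) auto
    finally show ?thesis .
  qed
  have dev_sum: "real (card {x \<in> realisations V A colour E l. colour (x i) (x j) = c})
      - card (realisations V A colour E l) / r = (\<Sum>y | y \<in> Y \<and> ok l y. dev (y i) (B y l) c)" for l c
    using split[of l "\<lambda>a z. colour a z = c"] split[of l "\<lambda>_ _. True"]
    by (simp add: dev_def sum_subtractf sum_divide_distrib)
  have indep: "B (v(i := a)) l = B v l" for v a l
  proof -
    have "\<forall>e\<in>Ej. fst e \<noteq> i \<and> snd e \<noteq> i"
      using new ij by (auto simp: Ej_def)
    then show ?thesis by (auto simp: B_def)
  qed
  have B_cong: "B y (restrict l Ej) = B y l" for y l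
    by (auto simp: B_def)
  have "(\<Sum>l\<in>E \<rightarrow>\<^sub>E C. \<Sum>c\<in>C.
           \<bar>real (card {x \<in> realisations V A colour E l. colour (x i) (x j) = c})
             - card (realisations V A colour E l) / r\<bar>)
      \<le> (\<Sum>l\<in>E \<rightarrow>\<^sub>E C. \<Sum>c\<in>C. \<Sum>y | y \<in> Y \<and> ok l y. \<bar>dev (y i) (B y l) c\<bar>)"
    unfolding dev_sum by (intro sum_mono sum_abs)
  also have "\<dots> = (\<Sum>l\<in>E \<rightarrow>\<^sub>E C. \<Sum>y | y \<in> Y \<and> ok l y. \<Sum>c\<in>C. \<bar>dev (y i) (B y l) c\<bar>)"
    by (intro sum.cong refl sum.swap)
  also have "\<dots> = (\<Sum>y\<in>Y. \<Sum>l | l \<in> (E \<rightarrow>\<^sub>E C) \<and> ok l y. \<Sum>c\<in>C. \<bar>dev (y i) (B y l) c\<bar>)"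
    using fEC(1) fY(1) by (rule sum.swap_restrict)
  \<comment> \<open>Given \<open>y\<close>, the colours away from \<open>j\<close> are forced, so a compatible pattern on \<open>E\<close> is known
    from its restriction to the edges at \<open>j\<close>.\<close>
  also have "\<dots> \<le> (\<Sum>y\<in>Y. \<Sum>l\<in>Ej \<rightarrow>\<^sub>E C. \<Sum>c\<in>C. \<bar>dev (y i) (B y l) c\<bar>)"
  proof (rule sum_mono)
    fix y
    let ?S = "{l. l \<in> (E \<rightarrow>\<^sub>E C) \<and> ok l y}"
    have inj: "inj_on (\<lambda>l. restrict l Ej) ?S"
    proof (rule inj_onI, clarify)
      fix l l' assume l: "l \<in> E \<rightarrow>\<^sub>E C" "ok l y" "l' \<in> E \<rightarrow>\<^sub>E C" "ok l' y"
        and eq: "restrict l Ej = restrict l' Ej"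
      show "l = l'"
      proof (rule PiE_ext[OF l(1,3)])
        fix e assume "e \<in> E"
        then show "l e = l' e"
          using l(2,4) fun_cong[OF eq, of e] by (cases "e \<in> Ej") (auto simp: ok_def)
      qed
    qed
    have sub: "(\<lambda>l. restrict l Ej) ` ?S \<subseteq> (Ej \<rightarrow>\<^sub>E C)"
      using EjE by (auto simp: PiE_def Pi_def)
    have "(\<Sum>l\<in>?S. \<Sum>c\<in>C. \<bar>dev (y i) (B y l) c\<bar>) =
        (\<Sum>l\<in>(\<lambda>l. restrict l Ej) ` ?S. \<Sum>c\<in>C. \<bar>dev (y i) (B y l) c\<bar>)"
      by (simp add: sum.reindex[OF inj] B_cong)
    also have "\<dots> \<le> (\<Sum>l\<in>Ej \<rightarrow>\<^sub>E C. \<Sum>c\<in>C. \<bar>dev (y i) (B y l) c\<bar>)"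
      by (intro sum_mono2 fEC sub sum_nonneg) auto
    finally show "(\<Sum>l\<in>?S. \<Sum>c\<in>C. \<bar>dev (y i) (B y l) c\<bar>)
        \<le> (\<Sum>l\<in>Ej \<rightarrow>\<^sub>E C. \<Sum>c\<in>C. \<bar>dev (y i) (B y l) c\<bar>)" .
  qed
  also have "\<dots> = (\<Sum>(y, l, c)\<in>Y \<times> (Ej \<rightarrow>\<^sub>E C) \<times> C. \<bar>dev (y i) (B y l) c\<bar>)"
    by (simp add: sum.cartesian_product)
  also have "\<dots> \<le> sqrt ((\<Sum>(y, l, c)\<in>Y \<times> (Ej \<rightarrow>\<^sub>E C) \<times> C. (dev (y i) (B y l) c)\<^sup>2)
      * card (Y \<times> (Ej \<rightarrow>\<^sub>E C) \<times> C))"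
    using sum_squared_le_sum_of_squares[of "\<lambda>(y, l, c). \<bar>dev (y i) (B y l) c\<bar>" "Y \<times> (Ej \<rightarrow>\<^sub>E C) \<times> C"]
    by (intro real_le_rsqrt) (simp add: case_prod_unfold)
  also have "\<dots> \<le> sqrt ((real (card A) ^ (card V - 2) * (D * card A))
      * (real (card A) ^ (card V - 1) * real r ^ m))"
  proof (intro real_sqrt_le_mono mult_mono)
    have "(\<Sum>(y, l, c)\<in>Y \<times> (Ej \<rightarrow>\<^sub>E C) \<times> C. (dev (y i) (B y l) c)\<^sup>2)
        = (\<Sum>y\<in>Y. \<Sum>l\<in>Ej \<rightarrow>\<^sub>E C. \<Sum>c\<in>C. (dev (y i) (B y l) c)\<^sup>2)"
      by (simp add: sum.cartesian_product)
    \<comment> \<open>Split off \<open>a = y i\<close>, on which \<open>B\<close> does not depend, and average over it first.\<close>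
    also have "\<dots> = (\<Sum>v\<in>Z. \<Sum>a\<in>A. \<Sum>l\<in>Ej \<rightarrow>\<^sub>E C. \<Sum>c\<in>C. (dev a (B v l) c)\<^sup>2)"
      unfolding Y_def Z_def
      by (subst Vij, subst sum_PiE_insert) (auto simp: indep)
    also have "\<dots> = (\<Sum>v\<in>Z. \<Sum>l\<in>Ej \<rightarrow>\<^sub>E C. \<Sum>a\<in>A. \<Sum>c\<in>C. (dev a (B v l) c)\<^sup>2)"
      by (intro sum.cong refl sum.swap)
    also have "\<dots> \<le> (\<Sum>v\<in>Z. \<Sum>l\<in>Ej \<rightarrow>\<^sub>E C. D * card (B v l))"
      unfolding dev_def by (intro sum_mono mixing BA)
    \<comment> \<open>The sets \<open>B v l\<close> for different patterns \<open>l\<close> are disjoint subsets of \<open>A\<close>.\<close>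
    also have "\<dots> \<le> (\<Sum>v\<in>Z. D * card A)"
    proof (rule sum_mono)
      fix v
      have "(\<Sum>l\<in>Ej \<rightarrow>\<^sub>E C. card (B v l)) = card (\<Union>l\<in>Ej \<rightarrow>\<^sub>E C. B v l)"
      proof (rule card_UN_disjoint[symmetric, OF fEC(2)])
        show "\<forall>l\<in>Ej \<rightarrow>\<^sub>E C. finite (B v l)" using fB by blast
        show "\<forall>l\<in>Ej \<rightarrow>\<^sub>E C. \<forall>l'\<in>Ej \<rightarrow>\<^sub>E C. l \<noteq> l' \<longrightarrow> B v l \<inter> B v l' = {}"
        proof (intro ballI impI, rule ccontr)
          fix l l' assume l: "l \<in> Ej \<rightarrow>\<^sub>E C" "l' \<in> Ej \<rightarrow>\<^sub>E C" "l \<noteq> l'" "B v l \<inter> B v l' \<noteq> {}"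
          then obtain z where z: "z \<in> B v l" "z \<in> B v l'" by blast
          have "l = l'"
            by (rule PiE_ext[OF l(1,2)]) (use z in \<open>simp add: B_def\<close>)
          then show False using l by simp
        qed
      qed
      also have "\<dots> \<le> card A" using BA fA by (intro card_mono) auto
      finally have "real (\<Sum>l\<in>Ej \<rightarrow>\<^sub>E C. card (B v l)) \<le> card A" by (rule of_nat_mono)
      then show "(\<Sum>l\<in>Ej \<rightarrow>\<^sub>E C. D * card (B v l)) \<le> D * card A"
        using D by (simp add: sum_distrib_left[symmetric] mult_left_mono)
    qed
    also have "\<dots> = real (card A) ^ (card V - 2) * (D * card A)"
      by (simp add: cardZ)
    finally show "(\<Sum>(y, l, c)\<in>Y \<times> (Ej \<rightarrow>\<^sub>E C) \<times> C. (dev (y i) (B y l) c)\<^sup>2)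
        \<le> real (card A) ^ (card V - 2) * (D * card A)" .
    have "real r ^ (card Ej + 1) \<le> real r ^ m"
      using deg r by (intro power_increasing) (auto simp: Ej_def)
    then have "real (card A) ^ (card V - 1) * real r ^ (card Ej + 1) \<le> real (card A) ^ (card V - 1) * real r ^ m"
      by (intro mult_left_mono) auto
    then show "real (card (Y \<times> (Ej \<rightarrow>\<^sub>E C) \<times> C)) \<le> real (card A) ^ (card V - 1) * real r ^ m"
      using fEj r by (simp add: card_cartesian_product cardY card_PiE mult_ac)
    show "0 \<le> real (card A) ^ (card V - 2) * (D * card A)" using D by simp
  qed simp
  also have "\<dots> = sqrt ((real (card A) ^ (card V - 1))\<^sup>2 * (D * real r ^ m))"
  proof -
    have "card V - 1 = Suc (card V - 2)" using cardV by simp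
    then have "real (card A) ^ (card V - 2) * card A = real (card A) ^ (card V - 1)" by simp
    then show ?thesis by (simp add: power2_eq_square algebra_simps)
  qed
  also have "\<dots> = real (card A) ^ (card V - 1) * sqrt (D * real r ^ m)"
    by (simp add: real_sqrt_mult)
  finally show ?thesis .
qed


text \<open>
  Divided by \<open>card A ^ card V\<close>, this bounds the \<open>L\<^sup>1\<close> distance between the distribution of the
  pattern of a random tuple and the uniform distribution.  Edges are added one at a time: the
  error made before is passed on to the \<open>r\<close> extensions of a pattern in equal parts, so that it does
  not grow, and \<open>new_edge_discrepancy\<close> bounds the error made by the new edge.
\<close>

lemma colouring_discrepancy:
  fixes D :: real and r :: nat and colour :: "'a \<Rightarrow> 'a \<Rightarrow> 'c"
  assumes fA: "finite A" and fC: "finite C" and r: "card C = r" "r > 0"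
    and D: "D \<ge> 0"
    and mixing: "\<And>B. B \<subseteq> A \<Longrightarrow>
      (\<Sum>x\<in>A. \<Sum>c\<in>C. (real (card {z \<in> B. colour x z = c}) - card B / r)\<^sup>2) \<le> D * card B"
    and fV: "finite V" and fE: "finite E" and EV: "E \<subseteq> V \<times> V"
    and simple: "\<And>i j. (i, j) \<in> E \<Longrightarrow> i \<noteq> j \<and> (j, i) \<notin> E"
    and deg: "\<And>j. j \<in> V \<Longrightarrow> card {e \<in> E. fst e = j \<or> snd e = j} \<le> m"
  shows "(\<Sum>l\<in>E \<rightarrow>\<^sub>E C.
           \<bar>real (card (realisations V A colour E l)) - real (card A) ^ card V / real r ^ card E\<bar>)
         \<le> card E * (real (card A) ^ (card V - 1) * sqrt (D * real r ^ m))"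
proof -
  have "(\<Sum>l\<in>G \<rightarrow>\<^sub>E C.
           \<bar>real (card (realisations V A colour G l)) - real (card A) ^ card V / real r ^ card G\<bar>)
         \<le> card G * (real (card A) ^ (card V - 1) * sqrt (D * real r ^ m))" if "G \<subseteq> E" for G
    using finite_subset[OF that fE] that
  proof (induction G rule: finite_induct)
    case empty
    then show ?case using fV by (simp add: realisations_def card_PiE)
  next
    case (insert e G)
    obtain i j where e: "e = (i, j)" by (cases e)
    have ij: "i \<in> V" "j \<in> V" "i \<noteq> j" and ji: "(j, i) \<notin> E"
      using insert EV simple[of i j] by (auto simp: e)
    define T where "T = real (card A) ^ card V"
    define R where "R l = real (card (realisations V A colour G l))" for l
    define Rc where "Rc l c = real (card {x \<in> realisations V A colour G l. colour (x i) (x j) = c})" for l c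
    define \<delta> where "\<delta> = real (card A) ^ (card V - 1) * sqrt (D * real r ^ m)"
    have ext: "realisations V A colour (insert e G) (l(e := c)) =
        {x \<in> realisations V A colour G l. colour (x i) (x j) = c}" for l c
      using \<open>e \<notin> G\<close> by (auto simp: realisations_def e)
    have "card {e \<in> G. fst e = j \<or> snd e = j} + 1 \<le> m"
    proof -
      have "card (insert e {e \<in> G. fst e = j \<or> snd e = j}) \<le> card {e \<in> E. fst e = j \<or> snd e = j}"
        using insert fE by (intro card_mono) (auto simp: e)
      then show ?thesis using deg[OF ij(2)] \<open>e \<notin> G\<close> \<open>finite G\<close> by simp
    qed
    then have new: "(\<Sum>l\<in>G \<rightarrow>\<^sub>E C. \<Sum>c\<in>C. \<bar>Rc l c - R l / r\<bar>) \<le> \<delta>"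
      unfolding Rc_def R_def \<delta>_def
      using insert ji by (intro new_edge_discrepancy fA fC r D mixing fV ij) (auto simp: e)
    have "(\<Sum>l\<in>insert e G \<rightarrow>\<^sub>E C.
          \<bar>real (card (realisations V A colour (insert e G) l)) - T / real r ^ card (insert e G)\<bar>)
        = (\<Sum>l\<in>G \<rightarrow>\<^sub>E C. \<Sum>c\<in>C. \<bar>Rc l c - T / real r ^ card G / r\<bar>)"
      using insert by (simp add: sum_PiE_insert ext Rc_def mult.commute)
    also have "\<dots> \<le> (\<Sum>l\<in>G \<rightarrow>\<^sub>E C. \<Sum>c\<in>C. \<bar>Rc l c - R l / r\<bar> + \<bar>R l - T / real r ^ card G\<bar> / r)"
    proof (intro sum_mono)
      fix l c
      have "Rc l c - T / real r ^ card G / r = (Rc l c - R l / r) + (R l - T / real r ^ card G) / r"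
        by (simp add: diff_divide_distrib)
      then show "\<bar>Rc l c - T / real r ^ card G / r\<bar>
          \<le> \<bar>Rc l c - R l / r\<bar> + \<bar>R l - T / real r ^ card G\<bar> / r"
        using abs_triangle_ineq[of "Rc l c - R l / r" "(R l - T / real r ^ card G) / r"] by simp
    qed
    also have "\<dots> = (\<Sum>l\<in>G \<rightarrow>\<^sub>E C. \<Sum>c\<in>C. \<bar>Rc l c - R l / r\<bar>) + (\<Sum>l\<in>G \<rightarrow>\<^sub>E C. \<bar>R l - T / real r ^ card G\<bar>)"
      using r by (simp add: sum.distrib)
    also have "\<dots> \<le> \<delta> + card G * \<delta>"
      using new insert by (simp add: R_def T_def \<delta>_def)
    also have "\<dots> = card (insert e G) * \<delta>"
      using insert by (simp add: algebra_simps)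
    finally show ?case by (simp add: T_def \<delta>_def)
  qed
  from this[OF subset_refl] show ?thesis .
qed

text \<open>
  A pattern without realisation contributes the full expected count
  \<open>card A ^ card V / r ^ card E\<close> to the discrepancy.
\<close>

lemma card_unrealised_le:
  fixes D :: real and r :: nat and colour :: "'a \<Rightarrow> 'a \<Rightarrow> 'c"
  assumes fA: "finite A" and fC: "finite C" and r: "card C = r" "r > 0"
    and D: "D \<ge> 0"
    and mixing: "\<And>B. B \<subseteq> A \<Longrightarrow>
      (\<Sum>x\<in>A. \<Sum>c\<in>C. (real (card {z \<in> B. colour x z = c}) - card B / r)\<^sup>2) \<le> D * card B"
    and fV: "finite V" and V: "V \<noteq> {}" and fE: "finite E" and EV: "E \<subseteq> V \<times> V"
    and simple: "\<And>i j. (i, j) \<in> E \<Longrightarrow> i \<noteq> j \<and> (j, i) \<notin> E"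
    and deg: "\<And>j. j \<in> V \<Longrightarrow> card {e \<in> E. fst e = j \<or> snd e = j} \<le> m"
  shows "real (card {l \<in> E \<rightarrow>\<^sub>E C. realisations V A colour E l = {}}) * card A
         \<le> card E * real r ^ card E * sqrt (D * real r ^ m)"
proof (cases "A = {}")
  case True
  then show ?thesis using D by simp
next
  case False
  let ?M = "{l \<in> E \<rightarrow>\<^sub>E C. realisations V A colour E l = {}}"
  let ?T = "real (card A) ^ card V / real r ^ card E"
  have pos: "real (card A) ^ (card V - 1) > 0" using False fA by (simp add: card_gt_0_iff)
  have "real (card ?M) * ?T = (\<Sum>l\<in>?M. \<bar>real (card (realisations V A colour E l)) - ?T\<bar>)"
    by simp
  also have "\<dots> \<le> (\<Sum>l\<in>E \<rightarrow>\<^sub>E C. \<bar>real (card (realisations V A colour E l)) - ?T\<bar>)"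
    using fE fC by (intro sum_mono2) (auto intro!: finite_PiE)
  also have "\<dots> \<le> card E * (real (card A) ^ (card V - 1) * sqrt (D * real r ^ m))"
    by (rule colouring_discrepancy[OF fA fC r D mixing fV fE EV simple deg])
  finally have "real (card ?M) * real (card A) ^ card V
      \<le> card E * (real (card A) ^ (card V - 1) * sqrt (D * real r ^ m)) * real r ^ card E"
    using r by (simp add: pos_divide_le_eq)
  moreover have "real (card A) ^ card V = real (card A) ^ (card V - 1) * card A"
    using V fV by (metis One_nat_def card_gt_0_iff mult.commute power_minus_mult)
  ultimately have "real (card A) ^ (card V - 1) * (real (card ?M) * card A)
      \<le> real (card A) ^ (card V - 1) * (card E * real r ^ card E * sqrt (D * real r ^ m))"
    by (simp add: algebra_simps)
  then show ?thesis using pos by (simp only: mult_le_cancel_left_pos)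
qed

section \<open>The norm system\<close>

lemma finite_index_pairs: "finite (index_pairs t)"
  by (rule finite_subset[of _ "{1..t} \<times> {1..t}"]) (auto simp: index_pairs_def)

lemma card_index_pairs: "card (index_pairs t) = t choose 2"
proof (induction t)
  case 0
  have "index_pairs 0 = {}" by (auto simp: index_pairs_def)
  then show ?case by simp
next
  case (Suc t)
  have "index_pairs (Suc t) = index_pairs t \<union> (\<lambda>i. (i, Suc t)) ` {1..t}"
    by (auto simp: index_pairs_def)
  moreover have "index_pairs t \<inter> (\<lambda>i. (i, Suc t)) ` {1..t} = {}"
    by (auto simp: index_pairs_def)
  moreover have "card ((\<lambda>i. (i, Suc t)) ` {1..t}) = t"
    by (subst card_image) (auto simp: inj_on_def)
  ultimately show ?case
    using Suc by (simp add: card_Un_disjoint finite_index_pairs numeral_2_eq_2)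
qed

lemma index_pairs_degree_le:
  assumes "j \<in> {1..t}"
  shows "card {e \<in> index_pairs t. fst e = j \<or> snd e = j} \<le> t - 1"
proof -
  let ?E = "{e \<in> index_pairs t. fst e = j \<or> snd e = j}"
  \<comment> \<open>An edge at \<open>j\<close> is determined by its other end.\<close>
  have "?E \<subseteq> (\<lambda>i. (min i j, max i j)) ` ({1..t} - {j})"
  proof
    fix e assume e: "e \<in> ?E"
    obtain a b where ab: "e = (a, b)" by (cases e)
    have *: "1 \<le> a" "a < b" "b \<le> t" using e by (auto simp: ab index_pairs_def)
    show "e \<in> (\<lambda>i. (min i j, max i j)) ` ({1..t} - {j})"
    proof (cases "a = j")
      case True
      then show ?thesis using * by (intro image_eqI[of _ _ b]) (auto simp: ab)
    next
      case False
      then show ?thesis using * e by (intro image_eqI[of _ _ a]) (auto simp: ab)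
    qed
  qed
  then have "card ?E \<le> card ({1..t} - {j})"
    by (intro surj_card_le) simp_all
  then show ?thesis using assms by simp
qed

lemma (in field) norm_colouring_mixing:
  assumes F: "subfield F R" and dim: "dimension n F (carrier R)" and fin: "finite F"
    and n: "n > 0" and A: "A \<subseteq> carrier R" and BA: "B \<subseteq> A"
  shows "(\<Sum>x\<in>A. \<Sum>c\<in>F - {\<zero>}.
           (real (card {z \<in> B. field_norm R (card F) n (x \<oplus> z) = c}) - card B / (card F - 1 :: nat))\<^sup>2)
         \<le> real (card F ^ n) * card B"
proof -
  let ?N = "field_norm R (card F) n"
  let ?M = "\<Sum>i<n. card F ^ i"
  note K = card_eq_card_subfield_power[OF F dim fin]
  have zero: "\<zero> \<in> F" and one: "\<one> \<in> F"
    using subringE[OF subfieldE(1)[OF F]] by auto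
  have gt: "card F > 1"
    using card_mono[OF fin, of "{\<zero>, \<one>}"] zero one by simp
  have pos: "?M > 0"
    using n by (intro sum_pos2[of _ 0]) auto
  have BK: "B \<subseteq> carrier R" using BA A by simp
  have gm: "(card F - 1) * ?M + 1 = card F ^ n"
    using geometric_sum_nat[of "card F" n] one_le_power[of "card F" n] gt by simp
  have "(\<Sum>x\<in>A. \<Sum>c\<in>F - {\<zero>}. (real (card {z \<in> B. ?N (x \<oplus> z) = c}) - card B / (card F - 1 :: nat))\<^sup>2)
      \<le> (\<Sum>x\<in>carrier R. \<Sum>c\<in>F - {\<zero>}.
          (real (card {z \<in> B. ?N (x \<oplus> z) = c}) - card B / (card F - 1 :: nat))\<^sup>2)"
    using K(1) A by (intro sum_mono2 sum_nonneg) auto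
  also have "\<dots> \<le> real (card (carrier R)) * card B"
  proof (rule sum_deviation_sq_le[where L = ?M])
    show "finite (carrier R)" "finite B" using K(1) BK finite_subset by auto
    show "card (F - {\<zero>}) = card F - 1" using zero fin by simp
    show "card (carrier R) = (card F - 1) * ?M + 1" using gm K(2) by simp
  next
    fix z assume z: "z \<in> B"
    then have zK: "z \<in> carrier R" using BK by blast
    have "{x \<in> carrier R. ?N (x \<oplus> z) \<in> F - {\<zero>}} = carrier R - {\<ominus> z}"
    proof -
      have "x \<oplus> z \<noteq> \<zero> \<longleftrightarrow> x \<noteq> \<ominus> z" if "x \<in> carrier R" for x
        using that zK minus_equality[of x z] l_neg[of z] by auto
      then show ?thesis
        using field_norm_nonzero_iff[OF F dim fin n] zK by blast
    qed
    then show "card {x \<in> carrier R. ?N (x \<oplus> z) \<in> F - {\<zero>}} = (card F - 1) * ?M"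
      using K z BK gm by (auto simp: card_Diff_singleton_if)
  next
    fix z w assume "z \<in> B" "w \<in> B" "z \<noteq> w"
    then show "card {x \<in> carrier R. ?N (x \<oplus> z) \<in> F - {\<zero>} \<and> ?N (x \<oplus> z) = ?N (x \<oplus> w)} \<le> ?M - 1"
      using card_equal_norm_shifts_le[OF F dim fin n] BK by blast
  qed (use fin gt pos in auto)
  finally show ?thesis using K(2) by simp
qed

text \<open>
  All patterns of nonzero colours are solvable except for the unrealised ones, which
  \<open>card_unrealised_le\<close> counts with \<open>D = q\<^sup>n\<close>, \<open>r = q - 1\<close> and degree at most \<open>t - 1\<close>.
\<close>

lemma (in field) card_solvable_choices_ge:
  assumes F: "subfield F R" and dim: "dimension n F (carrier R)" and fin: "finite F"
    and n: "n > 0" and t: "t > 0" and A: "A \<subseteq> carrier R" "A \<noteq> {}"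
  shows "real (card (solvable_choices R F n t A)) \<ge>
    real (card F - 1) ^ (t choose 2)
      - real (t choose 2) * real (card F) ^ (t choose 2) * (sqrt (real (card F) ^ (n + t)) / card A)"
proof -
  let ?N = "field_norm R (card F) n"
  let ?P = "index_pairs t"
  let ?k = "t choose 2"
  let ?real = "realisations {1..t} A (\<lambda>x z. ?N (x \<oplus> z)) ?P"
  let ?U = "?P \<rightarrow>\<^sub>E F - {\<zero>}"
  let ?M = "{l \<in> ?U. ?real l = {}}"
  let ?s = "sqrt (real (card F) ^ (n + t))"
  note K = card_eq_card_subfield_power[OF F dim fin]
  have zero: "\<zero> \<in> F" and one: "\<one> \<in> F"
    using subringE[OF subfieldE(1)[OF F]] by auto
  have gt: "card F > 1"
    using card_mono[OF fin, of "{\<zero>, \<one>}"] zero one by simp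
  have fA: "finite A" using K(1) A finite_subset by blast
  have cardA: "card A > 0" using fA A by (simp add: card_gt_0_iff)
  have cardU: "card ?U = (card F - 1) ^ ?k"
    using fin zero by (simp add: card_PiE finite_index_pairs card_index_pairs)
  have finU: "finite ?U" "finite (?P \<rightarrow>\<^sub>E F)"
    using fin by (auto intro!: finite_PiE finite_index_pairs)
  have "?U - ?M \<subseteq> solvable_choices R F n t A"
  proof
    fix l assume l: "l \<in> ?U - ?M"
    then obtain x where "x \<in> ?real l" by blast
    then have "norm_system_solvable R (card F) n t A l"
      unfolding norm_system_solvable_def realisations_def
      by (intro exI[of _ x]) (auto simp: PiE_def Pi_def)
    moreover have "l \<in> ?P \<rightarrow>\<^sub>E F" using l by auto
    ultimately show "l \<in> solvable_choices R F n t A" by (simp add: solvable_choices_def)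
  qed
  then have "card (?U - ?M) \<le> card (solvable_choices R F n t A)"
    using finU by (intro card_mono) (auto simp: solvable_choices_def)
  moreover have "card (?U - ?M) = card ?U - card ?M"
    using finU by (intro card_Diff_subset) auto
  moreover have "card ?M \<le> card ?U" using finU by (intro card_mono) auto
  ultimately have "real (card ?U) - card ?M \<le> card (solvable_choices R F n t A)" by linarith
  moreover have "real (card ?M) \<le> real ?k * real (card F) ^ ?k * (?s / card A)"
  proof -
    have "real (card ?M) * card A
        \<le> card ?P * real (card F - 1) ^ card ?P * sqrt (real (card F ^ n) * real (card F - 1) ^ (t - 1))"
    proof (rule card_unrealised_le)
      show "(\<Sum>x\<in>A. \<Sum>c\<in>F - {\<zero>}. (real (card {z \<in> B. ?N (x \<oplus> z) = c}) - card B / (card F - 1 :: nat))\<^sup>2)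
          \<le> real (card F ^ n) * card B" if "B \<subseteq> A" for B
        using norm_colouring_mixing[OF F dim fin n A(1) that] .
      show "card {e \<in> ?P. fst e = j \<or> snd e = j} \<le> t - 1" if "j \<in> {1..t}" for j
        using index_pairs_degree_le[OF that] .
    qed (use fA fin zero gt t finite_index_pairs in \<open>auto simp: index_pairs_def\<close>)
    also have "\<dots> \<le> real ?k * real (card F) ^ ?k * ?s"
    proof (intro mult_mono power_mono real_sqrt_le_mono)
      have "real (card F ^ n) * real (card F - 1) ^ (t - 1) \<le> real (card F) ^ n * real (card F) ^ (t - 1)"
        by (intro mult_mono power_mono) auto
      also have "\<dots> \<le> real (card F) ^ (n + t)"
        unfolding power_add[symmetric] using gt by (intro power_increasing) auto
      finally show "real (card F ^ n) * real (card F - 1) ^ (t - 1) \<le> real (card F) ^ (n + t)" .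
    qed (auto simp: card_index_pairs intro!: power_mono)
    finally show ?thesis using cardA by (simp add: pos_le_divide_eq)
  qed
  ultimately show ?thesis using cardU by simp
qed

theorem theorem2p11:
  fixes n t :: nat
    and q :: "nat \<Rightarrow> nat"
    and K :: "nat \<Rightarrow> ('a, 'b) ring_scheme"
    and F A :: "nat \<Rightarrow> 'a set"
  assumes "n \<ge> 2" and "t \<ge> 2"
    and "\<And>k. \<exists>p m. Factorial_Ring.prime (p::nat) \<and> odd p \<and> m > 0 \<and> q k = p ^ m"
    and "filterlim q at_top sequentially"
    and "\<And>k. field (K k)"
    and "\<And>k. subfield (F k) (K k)"
    and "\<And>k. card (F k) = q k"
    and "\<And>k. ring.dimension (K k) n (F k) (carrier (K k))"
    and "\<And>k. A k \<subseteq> carrier (K k)"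
    and "(\<lambda>k. real (q k) powr (real (n + t) / 2)) \<in> o(\<lambda>k. real (card (A k)))"
  shows "\<exists>\<epsilon> :: nat \<Rightarrow> real. \<epsilon> \<longlonglongrightarrow> 0 \<and>
    (\<forall>k. real (card (solvable_choices (K k) (F k) n t (A k)))
           \<ge> (1 - \<epsilon> k) * real (q k) ^ (t choose 2))"
proof -
  let ?sol = "\<lambda>k. real (card (solvable_choices (K k) (F k) n t (A k)))"
  let ?c = "t choose 2"
  let ?p = "\<lambda>k. real (q k) powr (real (n + t) / 2)"
  \<comment> \<open>The exact proportion of unsolvable choices.  The estimate below divides by \<open>card (A k)\<close>
    and holds only where \<open>A k\<close> is nonempty, that is, for all large \<open>k\<close>.\<close>
  define \<epsilon> where "\<epsilon> k = 1 - ?sol k / real (q k) ^ ?c" for k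
  have q: "q k > 0" for k
    using assms(3)[of k] by (auto intro: prime_gt_0_nat)
  have fin: "finite (F k)" for k
    using assms(7)[of k] q[of k] card_ge_0_finite by metis
  have nonneg: "\<epsilon> k \<ge> 0" for k
  proof -
    have "finite (index_pairs t \<rightarrow>\<^sub>E F k)"
      using fin by (auto intro!: finite_PiE finite_index_pairs)
    then have "card (solvable_choices (K k) (F k) n t (A k)) \<le> card (index_pairs t \<rightarrow>\<^sub>E F k)"
      by (rule card_mono) (auto simp: solvable_choices_def)
    also have "\<dots> = q k ^ ?c"
      using assms(7) by (simp add: card_PiE finite_index_pairs card_index_pairs)
    finally have "?sol k \<le> real (q k ^ ?c)" by (rule of_nat_mono)
    then show ?thesis using q[of k] by (simp add: \<epsilon>_def)
  qed
  have upper: "\<epsilon> k \<le> 1 - (1 - 1 / real (q k)) ^ ?c + ?c * (?p k / card (A k))" if "A k \<noteq> {}" for k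
  proof -
    interpret field "K k" by (rule assms(5))
    have qr: "real (q k) > 0" "real (q k) \<noteq> 0" using q[of k] by auto
    have s: "sqrt (real (q k) ^ (n + t)) = ?p k"
      using qr by (simp add: powr_half_sqrt[symmetric] powr_realpow[symmetric] powr_powr)
    have "?sol k \<ge> real (q k - 1) ^ ?c - ?c * real (q k) ^ ?c * (?p k / card (A k))"
      using card_solvable_choices_ge[OF assms(6,8) fin, of t "A k"] assms(1,2,7,9) that s by simp
    then have "?sol k / real (q k) ^ ?c
        \<ge> (real (q k - 1) ^ ?c - ?c * real (q k) ^ ?c * (?p k / card (A k))) / real (q k) ^ ?c"
      by (rule divide_right_mono) simp
    also have "(real (q k - 1) ^ ?c - ?c * real (q k) ^ ?c * (?p k / card (A k))) / real (q k) ^ ?c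
        = (1 - 1 / real (q k)) ^ ?c - ?c * (?p k / card (A k))"
    proof -
      define u where "u = 1 - 1 / real (q k)"
      have "real (q k - 1) = u * real (q k)"
        using q[of k] by (simp add: u_def of_nat_diff algebra_simps)
      then have "real (q k - 1) ^ ?c / real (q k) ^ ?c = u ^ ?c"
        using qr by (simp add: power_mult_distrib)
      then show ?thesis
        using qr unfolding u_def[symmetric] diff_divide_distrib by simp
    qed
    finally show ?thesis by (simp add: \<epsilon>_def)
  qed
  have "eventually (\<lambda>k. norm (?p k) \<le> 1 * norm (real (card (A k)))) sequentially"
    by (rule landau_o.smallD[OF assms(10)]) simp
  then have "eventually (\<lambda>k. A k \<noteq> {}) sequentially"
  proof eventually_elim
    case (elim k)
    moreover have "?p k > 0" using q[of k] by simp
    ultimately show ?case by auto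
  qed
  then have "eventually (\<lambda>k. \<epsilon> k \<le> 1 - (1 - 1 / real (q k)) ^ ?c + ?c * (?p k / card (A k))) sequentially"
    by eventually_elim (rule upper)
  moreover have "(\<lambda>k. 1 - (1 - 1 / real (q k)) ^ ?c + ?c * (?p k / card (A k))) \<longlonglongrightarrow> 1 - (1 - 0) ^ ?c + real ?c * (0 :: real)"
  proof (intro tendsto_intros)
    show "(\<lambda>k. 1 / real (q k)) \<longlonglongrightarrow> 0"
      using filterlim_compose[OF lim_1_over_n assms(4)] .
    show "(\<lambda>k. ?p k / card (A k)) \<longlonglongrightarrow> 0"
      using smalloD_tendsto[OF assms(10)] .
  qed
  ultimately have "\<epsilon> \<longlonglongrightarrow> 0"
    using nonneg by (intro tendsto_sandwich[of "\<lambda>_. 0" \<epsilon> sequentially]) auto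
  moreover have "(1 - \<epsilon> k) * real (q k) ^ ?c \<le> ?sol k" for k
    using q[of k] by (simp add: \<epsilon>_def)
  ultimately show ?thesis by blast
qed

end
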